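(* Let $p$ be a prime with $p\equiv 3 \pmod 4$, let $x+y\sqrt{p}$ (with $x,y\in\mathbb{Z}$) be the fundamental unit of the real quadratic field $\mathbb{Q}(\sqrt{p})$, let $l$ be the (even) period length of the regular continued fraction of $\sqrt{p}$, and let $h_i$ denote the denominator of the $i$-th convergent of $\sqrt{p}$. Then $p$ divides $y$ if and only if $p$ divides $h_{\frac{l}{2}-1}$.
   Context: For a prime $p$, the regular continued fraction of $\sqrt{p}$ has the form $\sqrt{p}=\langle n,\overline{a_1,a_2,\ldots,a_{l-1},2n}\rangle$, where $n=\lfloor\sqrt{p}\rfloor$, the bar denotes the repeating block, $l$ is the length of the (minimal) period, and $a_i=a_{l-i}$ for $1\le i\le l-1$; write $a_i$ ($i\ge 1$) for the successive partial quotients. The convergent denominators are given by $h_{-1}=0$, $h_0=1$, $h_{i+1}=a_{i+1}h_i+h_{i-1}$ for $i\ge 0$. When $p\equiv 3 \pmod 4$, $l$ is even. The fundamental unit of $\mathbb{Q}(\sqrt{p})$ is the smallest unit $>1$ of its ring of integers, which is $\mathbb{Z}[\sqrt{p}]$ when $p\equiv 3\pmod 4$. *)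

theory Defs
  imports "HOL-Number_Theory.Number_Theory" "HOL-Computational_Algebra.Computational_Algebra" Complex_Main
begin

text \<open>
  Regular continued fractions. \<open>complete_quotient x n\<close> is the real number \<open>x\<^sub>n\<close> with
  \<open>x = \<langle>a\<^sub>0, \<dots>, a\<^bsub>n-1\<^esub>, x\<^sub>n\<rangle>\<close>. For irrational \<open>x\<close> the fractional part never vanishes; for
  rational \<open>x\<close> the values after termination of the expansion are meaningless.
\<close>

fun complete_quotient :: "real \<Rightarrow> nat \<Rightarrow> real" where
  "complete_quotient x 0 = x"
| "complete_quotient x (Suc n) = 1 / frac (complete_quotient x n)"

definition partial_quotient :: "real \<Rightarrow> nat \<Rightarrow> int" where
  "partial_quotient x n = \<lfloor>complete_quotient x n\<rfloor>"

text \<open>The second equation is the general recurrence at \<open>i = 0\<close>, with \<open>h\<^bsub>-1\<^esub> = 0\<close> substituted.\<close>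

fun convergent_denom :: "real \<Rightarrow> nat \<Rightarrow> int" where
  "convergent_denom x 0 = 1"
| "convergent_denom x (Suc 0) = partial_quotient x 1"
| "convergent_denom x (Suc (Suc i)) =
     partial_quotient x (Suc (Suc i)) * convergent_denom x (Suc i) + convergent_denom x i"

text \<open>
  Minimal period length of an expansion whose repeating block begins with \<open>a\<^sub>1\<close>, as is the case
  for the square root of a non-square natural number.
\<close>

definition cf_period_length :: "real \<Rightarrow> nat" where
  "cf_period_length x =
     (LEAST l. l > 0 \<and> (\<forall>i\<ge>1. partial_quotient x (i + l) = partial_quotient x i))"

definition real_quadratic_field :: "nat \<Rightarrow> real set" where
  "real_quadratic_field d = {a + b * sqrt (real d) | a b. a \<in> \<rat> \<and> b \<in> \<rat>}"

definition ring_of_integers :: "real set \<Rightarrow> real set" where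
  "ring_of_integers K = {z \<in> K. algebraic_int z}"

definition integer_units :: "real set \<Rightarrow> real set" where
  "integer_units K = {u \<in> ring_of_integers K. \<exists>v \<in> ring_of_integers K. u * v = 1}"

definition is_fundamental_unit :: "real set \<Rightarrow> real \<Rightarrow> bool" where
  "is_fundamental_unit K u \<longleftrightarrow>
     u \<in> integer_units K \<and> u > 1 \<and> (\<forall>v \<in> integer_units K. v > 1 \<longrightarrow> u \<le> v)"

end

theory Submission
  imports Defs
begin

text \<open>
  Write \<open>s = \<surd>p\<close> and \<open>\<epsilon> = x + y s\<close>. Since \<open>p \<equiv> 3 (mod 4)\<close>, the number \<open>\<epsilon>\<close> has norm \<open>1\<close>, so
  \<open>(x - 1)(x + 1) = p y\<^sup>2\<close>. If \<open>x\<close> were odd, halving both factors would produce either a unit whose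
  square is \<open>\<epsilon>\<close>, against minimality, or an element of norm \<open>-1\<close>, impossible modulo \<open>4\<close>. So \<open>x\<close> is even, the factors are coprime, and one is a square while the
  other is \<open>p\<close> times a square. This gives odd \<open>a, b > 0\<close> with \<open>y = a b\<close>, \<open>b\<^sup>2 - p a\<^sup>2 = \<plusminus>2\<close> and
  \<open>(b + a s)\<^sup>2 = 2 \<epsilon>\<close> (lemma \<open>fundamental_unit_factorization\<close>). If \<open>p\<close> divided \<open>b\<close>, it would divide \<open>2\<close>;
  so \<open>p\<close> divides \<open>y\<close> iff it divides \<open>a\<close>, and it remains to recognise \<open>a\<close> as the denominator of
  the convergent in the middle of the period.

  That \<open>b/a\<close> is a convergent at all follows from a descent on integer Moebius transformations
  (lemma \<open>moebius_complete_quotient\<close>): with \<open>Q\<close> the odd integer satisfying \<open>Q \<le> s < Q + 2\<close>, the number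
  \<open>(Q + s)/2\<close> is a complete quotient \<open>x\<^sub>K\<close> of \<open>s\<close>, and \<open>b/a\<close> is the convergent in front of it.

  To see that \<open>K\<close> is the middle, let \<open>W\<^sub>j = N\<^sub>j + H\<^sub>j s\<close> combine the numerators and denominators of the
  convergents. The recurrence for \<open>W\<close> says that \<open>W\<^bsub>j+1\<^esub>/W\<^sub>j\<close> has integer part \<open>a\<^sub>j\<close> and that
  passing to the reciprocal of its fractional part lowers \<open>j\<close> by one: these quotients run through
  the expansion backwards. At \<open>K\<close> the forward and the backward expansions meet, because
  \<open>W\<^bsub>K+1\<^esub>/W\<^sub>K = (Q + s)/2 = x\<^sub>K\<close>. So \<open>x\<^bsub>2K\<^esub> = W\<^sub>1/W\<^sub>0 = \<lfloor>s\<rfloor> + s\<close> and \<open>2K\<close> is a period (lemma \<open>palindrome\<close>).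

  Finally \<open>2K\<close> is the least period \<open>l\<close>. Every period yields a unit \<open>W\<^sub>l \<ge> \<epsilon> = W\<^sub>K\<^sup>2/2\<close>, and
  \<open>W\<^sub>K = b + a s > 2\<close>, so \<open>W\<^sub>l > W\<^sub>K\<close> and \<open>l > K\<close>; then \<open>2K - l < l\<close> would be a smaller
  period unless it is \<open>0\<close> (lemma \<open>cf_period_length_eq_twice_middle\<close>).
\<close>

section \<open>Convergents and complete quotients\<close>

text \<open>
  Numerators and denominators are indexed so that the pair at \<open>k\<close> is the convergent just before the
  complete quotient \<open>x\<^sub>k\<close>. The index is thus one more than the usual one, and the conventional
  values at \<open>-1\<close> sit at \<open>0\<close>.
\<close>

fun cf_num :: "real \<Rightarrow> nat \<Rightarrow> int" where
  "cf_num \<xi> 0 = 1"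
| "cf_num \<xi> (Suc 0) = partial_quotient \<xi> 0"
| "cf_num \<xi> (Suc (Suc i)) = partial_quotient \<xi> (Suc i) * cf_num \<xi> (Suc i) + cf_num \<xi> i"

fun cf_den :: "real \<Rightarrow> nat \<Rightarrow> int" where
  "cf_den \<xi> 0 = 0"
| "cf_den \<xi> (Suc 0) = 1"
| "cf_den \<xi> (Suc (Suc i)) = partial_quotient \<xi> (Suc i) * cf_den \<xi> (Suc i) + cf_den \<xi> i"

lemma convergent_denom_eq_cf_den: "convergent_denom \<xi> i = cf_den \<xi> (Suc i)"
  by (induction \<xi> i rule: convergent_denom.induct) auto

lemma cf_determinant:
  "cf_num \<xi> (Suc k) * cf_den \<xi> k - cf_num \<xi> k * cf_den \<xi> (Suc k) = (-1) ^ Suc k"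
  by (induction k) (simp_all add: algebra_simps)

lemma complete_quotient_add:
  "complete_quotient (complete_quotient \<xi> m) n = complete_quotient \<xi> (m + n)"
  by (induction n) auto

lemma partial_quotient_complete_quotient:
  "partial_quotient (complete_quotient \<xi> m) n = partial_quotient \<xi> (m + n)"
  by (simp add: partial_quotient_def complete_quotient_add)

lemma complete_quotient_eq_Suc:
  "complete_quotient \<xi> k =
     of_int (partial_quotient \<xi> k) + 1 / complete_quotient \<xi> (Suc k)"
  by (simp add: partial_quotient_def frac_def)

text \<open>
  The integer part and the reciprocal of the fractional part can be read off from any
  representation \<open>q + 1/\<zeta>\<close>, provided \<open>\<zeta> > 1\<close> makes \<open>1/\<zeta>\<close> a proper fraction.
\<close>

lemma complete_quotient_SucI:
  assumes "complete_quotient \<xi> k = of_int q + 1 / \<zeta>" and "\<zeta> > 1"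
  shows "complete_quotient \<xi> (Suc k) = \<zeta>" and "partial_quotient \<xi> k = q"
proof -
  have "0 < 1 / \<zeta>" "1 / \<zeta> < 1" using assms(2) by simp_all
  then show q: "partial_quotient \<xi> k = q"
    unfolding partial_quotient_def assms(1) by linarith
  show "complete_quotient \<xi> (Suc k) = \<zeta>"
    using assms(1) q by (simp add: frac_def partial_quotient_def)
qed

lemma complete_quotient_irrational:
  assumes "\<xi> \<notin> \<rat>"
  shows "complete_quotient \<xi> k \<notin> \<rat>"
proof (induction k)
  case (Suc k)
  have "complete_quotient \<xi> k \<in> \<rat>" if "complete_quotient \<xi> (Suc k) \<in> \<rat>"
    by (subst complete_quotient_eq_Suc) (intro Rats_add Rats_of_int Rats_divide Rats_1 that)
  with Suc show ?case by blast
qed (use assms in simp)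

lemma complete_quotient_Suc_gt_1:
  assumes "\<xi> \<notin> \<rat>"
  shows "complete_quotient \<xi> (Suc k) > 1"
proof -
  have "frac (complete_quotient \<xi> k) \<noteq> 0"
    using complete_quotient_irrational[OF assms, of k] by (auto simp: Ints_subset_Rats[THEN subsetD])
  then have "frac (complete_quotient \<xi> k) > 0"
    using frac_ge_0[of "complete_quotient \<xi> k"] by linarith
  then show ?thesis using frac_lt_1[of "complete_quotient \<xi> k"] by simp
qed

lemma partial_quotient_Suc_ge_1:
  assumes "\<xi> \<notin> \<rat>"
  shows "partial_quotient \<xi> (Suc k) \<ge> 1"
  using complete_quotient_Suc_gt_1[OF assms, of k] by (simp add: partial_quotient_def del: complete_quotient.simps)

text \<open>
  This is \<open>\<xi> = (N\<^sub>k x\<^sub>k + N\<^bsub>k-1\<^esub>)/(H\<^sub>k x\<^sub>k + H\<^bsub>k-1\<^esub>)\<close>, the expression of a number by a tail of its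
  expansion, with the denominator cleared.
\<close>

lemma eq_num_den_complete_quotient:
  assumes "\<xi> \<notin> \<rat>"
  shows "\<xi> * (cf_den \<xi> (Suc k) * complete_quotient \<xi> (Suc k) + cf_den \<xi> k) =
           cf_num \<xi> (Suc k) * complete_quotient \<xi> (Suc k) + cf_num \<xi> k"
proof (induction k)
  case 0
  show ?case
    using complete_quotient_Suc_gt_1[OF assms, of 0] complete_quotient_eq_Suc[of \<xi> 0]
    by (simp add: field_simps del: complete_quotient.simps(2))
next
  case (Suc k)
  define z where "z = complete_quotient \<xi> (Suc (Suc k))"
  have z: "z > 1" using complete_quotient_Suc_gt_1[OF assms, of "Suc k"] by (simp add: z_def)
  have e: "z * complete_quotient \<xi> (Suc k) = partial_quotient \<xi> (Suc k) * z + 1"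
    using complete_quotient_eq_Suc[of \<xi> "Suc k"] z unfolding z_def[symmetric]
    by (simp add: field_simps)
  have "\<xi> * (cf_den \<xi> (Suc k) * (z * complete_quotient \<xi> (Suc k)) + cf_den \<xi> k * z) =
         cf_num \<xi> (Suc k) * (z * complete_quotient \<xi> (Suc k)) + cf_num \<xi> k * z"
    using arg_cong[OF Suc.IH, of "\<lambda>t. z * t"] by (simp only: algebra_simps)
  then show ?case unfolding e z_def[symmetric] by (simp add: algebra_simps)
qed

text \<open>
  Equal integer parts cancel, so \<open>u\<^sub>j - v\<^sub>j = 1/u\<^bsub>j+1\<^esub> - 1/v\<^bsub>j+1\<^esub>\<close>, and each step multiplies the distance by
  \<open>u\<^bsub>j+1\<^esub> v\<^bsub>j+1\<^esub>\<close>. A single factor may be close to \<open>1\<close>, but two successive complete quotients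
  have product \<open>a\<^sub>j x\<^bsub>j+1\<^esub> + 1 \<ge> 2\<close>; hence the steps are taken in pairs.
\<close>

lemma same_partial_quotients_distance:
  assumes "u \<notin> \<rat>" "v \<notin> \<rat>" and eq: "\<And>i. partial_quotient u i = partial_quotient v i"
  shows "4 ^ k * \<bar>u - v\<bar> \<le> \<bar>complete_quotient u (2 * k) - complete_quotient v (2 * k)\<bar>"
proof (induction k)
  case (Suc k)
  have step: "\<bar>complete_quotient u j - complete_quotient v j\<bar> *
      (complete_quotient u (Suc j) * complete_quotient v (Suc j)) =
      \<bar>complete_quotient u (Suc j) - complete_quotient v (Suc j)\<bar>" for j
  proof -
    define s t where "s = complete_quotient u (Suc j)" and "t = complete_quotient v (Suc j)"
    have st: "s > 1" "t > 1" using complete_quotient_Suc_gt_1 assms by (auto simp: s_def t_def)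
    have "complete_quotient u j - complete_quotient v j = 1 / s - 1 / t"
      using complete_quotient_eq_Suc[of u j] complete_quotient_eq_Suc[of v j] eq[of j]
      unfolding s_def[symmetric] t_def[symmetric] by linarith
    also have "\<dots> = (t - s) / (s * t)" using st by (simp add: field_simps)
    finally have "complete_quotient u j - complete_quotient v j = (t - s) / (s * t)" .
    then show ?thesis unfolding s_def[symmetric] t_def[symmetric] using st by (simp add: abs_mult)
  qed
  have two: "complete_quotient w (Suc j) * complete_quotient w (Suc (Suc j)) \<ge> 2"
    if "w \<notin> \<rat>" for w j
  proof -
    define s t where "s = complete_quotient w (Suc j)" and "t = complete_quotient w (Suc (Suc j))"
    have t: "t > 1" unfolding t_def by (rule complete_quotient_Suc_gt_1[OF that])
    have "s * t = partial_quotient w (Suc j) * t + 1"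
      using complete_quotient_eq_Suc[of w "Suc j"] t
      unfolding s_def[symmetric] t_def[symmetric] by (simp add: field_simps)
    moreover have "partial_quotient w (Suc j) * t \<ge> 1 * 1"
      using partial_quotient_Suc_ge_1[OF that, of j] t by (intro mult_mono) auto
    ultimately show ?thesis by (simp add: s_def t_def)
  qed
  define d where "d = (\<lambda>j. \<bar>complete_quotient u j - complete_quotient v j\<bar>)"
  have "d (2 * Suc k) = d (2 * k) *
     ((complete_quotient u (Suc (2 * k)) * complete_quotient u (Suc (Suc (2 * k)))) *
      (complete_quotient v (Suc (2 * k)) * complete_quotient v (Suc (Suc (2 * k)))))"
    using step[of "Suc (2 * k)"] unfolding step[of "2 * k", symmetric] d_def
    by (simp add: mult_ac del: complete_quotient.simps)
  also have "\<dots> \<ge> d (2 * k) * (2 * 2)"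
    using two[OF assms(1), of "2 * k"] two[OF assms(2), of "2 * k"]
    by (intro mult_left_mono mult_mono) (auto simp: d_def)
  finally show ?case using Suc.IH by (simp add: d_def del: complete_quotient.simps)
qed simp

text \<open>
  Otherwise the distance of the complete quotients would grow without bound, although numbers with
  equal integer parts differ by less than \<open>1\<close>.
\<close>

lemma partial_quotients_determine:
  assumes "u \<notin> \<rat>" "v \<notin> \<rat>" and eq: "\<And>i. partial_quotient u i = partial_quotient v i"
  shows "u = v"
proof (rule ccontr)
  assume "u \<noteq> v"
  then have "\<bar>u - v\<bar> > 0" by simp
  obtain k where "1 / \<bar>u - v\<bar> < 4 ^ k"
    using real_arch_pow[of 4 "1 / \<bar>u - v\<bar>"] by auto
  then have "1 < 4 ^ k * \<bar>u - v\<bar>"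
    using \<open>\<bar>u - v\<bar> > 0\<close> by (simp add: field_simps)
  also have "\<dots> \<le> \<bar>complete_quotient u (2 * k) - complete_quotient v (2 * k)\<bar>"
    by (rule same_partial_quotients_distance[OF assms])
  finally have "1 < \<bar>complete_quotient u (2 * k) - complete_quotient v (2 * k)\<bar>" .
  then show False using eq[of "2 * k"] unfolding partial_quotient_def by linarith
qed

section \<open>Recognising complete quotients\<close>

text \<open>
  A refinement of a classical criterion for \<open>B/D\<close> and \<open>A/C\<close> to be consecutive convergents. Dividing
  \<open>C\<close> by \<open>D\<close> strips the last partial quotient \<open>q\<close>: the tail \<open>\<zeta>\<close> becomes \<open>q + 1/\<zeta>\<close>, the columns of the
  matrix move to \<open>(B, D)\<close> and \<open>(A - q B, C - q D)\<close>, and the determinant changes sign.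

  The two ranges for \<open>D\<close>, according to the sign of the determinant, are exactly what
  makes the descent unambiguous when \<open>D\<close> divides \<open>C\<close>: then the remainder may be chosen as
  \<open>0\<close> or as \<open>D\<close>, reflecting the two expansions of a rational number, and the determinant decides.
  With \<open>0 \<le> D \<le> C\<close> alone the claim fails, for instance for \<open>\<xi> = A - 1/\<zeta>\<close>.
\<close>

lemma moebius_complete_quotient:
  fixes \<xi> \<zeta> :: real and A B C D e :: int
  assumes "\<xi> * (C * \<zeta> + D) = A * \<zeta> + B" and "\<zeta> > 1" and "A * D - B * C = e"
    and "e = 1 \<and> 0 < D \<and> D \<le> C \<or> e = -1 \<and> 0 \<le> D \<and> D < C"
  shows "\<exists>k. complete_quotient \<xi> (Suc k) = \<zeta> \<and> cf_num \<xi> (Suc k) = A \<and> cf_num \<xi> k = B \<and>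
             cf_den \<xi> (Suc k) = C \<and> cf_den \<xi> k = D"
  using assms
proof (induction "nat (C + D)" arbitrary: A B C D e \<zeta> rule: less_induct)
  case less
  note rel = less.prems(1) and zeta = less.prems(2) and det = less.prems(3)
  show ?case
  proof (cases "D = 0")
    case True
    then have "e = -1" "C > 0" "B * C = 1" using less.prems(3,4) by auto
    then have "C = 1" "B = 1" using pos_zmult_eq_1_iff[of C B] by (auto simp: mult.commute)
    with True rel have "\<xi> * \<zeta> = A * \<zeta> + 1" by simp
    then have "complete_quotient \<xi> 0 = A + 1 / \<zeta>" using zeta by (simp add: field_simps)
    from complete_quotient_SucI[OF this zeta] True \<open>C = 1\<close> \<open>B = 1\<close> show ?thesis
      by (intro exI[of _ 0]) auto
  next
    case False
    \<comment> \<open>For determinant \<open>1\<close> the remainder lies in \<open>{0..<D}\<close>, for determinant \<open>-1\<close> in \<open>{1..D}\<close>.\<close>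
    obtain q C' where qC: "C = q * D + C'" "q \<ge> 1"
      and C': "- e = 1 \<and> 0 < C' \<and> C' \<le> D \<or> - e = -1 \<and> 0 \<le> C' \<and> C' < D"
    proof (cases "e = 1")
      case True
      show ?thesis
      proof (rule that[of "C div D" "C mod D"])
        have "C div D \<ge> D div D" using True less.prems(4) by (intro zdiv_mono1) auto
        then show "C div D \<ge> 1" using False by simp
      qed (use True less.prems(4) in auto)
    next
      case eF: False
      then have *: "0 < D" "D \<le> C - 1" using False less.prems(4) by auto
      show ?thesis
      proof (rule that[of "(C - 1) div D" "(C - 1) mod D + 1"])
        have "(C - 1) div D \<ge> D div D" using * by (intro zdiv_mono1) auto
        then show "(C - 1) div D \<ge> 1" using False by simp
        show "C = (C - 1) div D * D + ((C - 1) mod D + 1)"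
          using div_mult_mod_eq[of "C - 1" D] by linarith
        have "0 \<le> (C - 1) mod D" "(C - 1) mod D < D" using * by auto
        then show "- e = 1 \<and> 0 < (C - 1) mod D + 1 \<and> (C - 1) mod D + 1 \<le> D \<or>
          - e = -1 \<and> 0 \<le> (C - 1) mod D + 1 \<and> (C - 1) mod D + 1 < D"
          using eF less.prems(4) by auto
      qed
    qed
    have D: "D > 0" using less.prems(4) False by auto
    define A' where "A' = A - q * B"
    define \<zeta>' where "\<zeta>' = q + 1 / \<zeta>"
    have q1: "real_of_int q \<ge> 1" using qC(2) by linarith
    have "1 / \<zeta> > 0" using zeta by simp
    with q1 have z': "\<zeta>' > 1" unfolding \<zeta>'_def by linarith
    have zz: "\<zeta> * \<zeta>' = q * \<zeta> + 1" using zeta by (simp add: \<zeta>'_def field_simps)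
    have "\<zeta> * (\<xi> * (D * \<zeta>' + C')) = \<zeta> * (B * \<zeta>' + A')"
    proof -
      have "\<zeta> * (\<xi> * (D * \<zeta>' + C')) = \<xi> * (D * (\<zeta> * \<zeta>') + C' * \<zeta>)" by (simp add: algebra_simps)
      also have "\<dots> = \<xi> * (C * \<zeta> + D)" unfolding zz qC(1) by (simp add: algebra_simps)
      also have "\<dots> = B * (\<zeta> * \<zeta>') + A' * \<zeta>" unfolding rel zz A'_def by (simp add: algebra_simps)
      finally show ?thesis by (simp add: algebra_simps)
    qed
    then have rel': "\<xi> * (D * \<zeta>' + C') = B * \<zeta>' + A'" using zeta by simp
    have det': "B * C' - A' * D = - e"
      using det by (simp add: A'_def qC(1) algebra_simps)
    have "C' < C" using qC C' D mult_mono[of 1 q D D] by auto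
    then have "nat (D + C') < nat (C + D)" using D C' by auto
    from less.hyps[OF this rel' z' det' C'] obtain k where
      k: "complete_quotient \<xi> (Suc k) = \<zeta>'" "cf_num \<xi> (Suc k) = B" "cf_num \<xi> k = A'"
         "cf_den \<xi> (Suc k) = D" "cf_den \<xi> k = C'" by blast
    have "complete_quotient \<xi> (Suc k) = q + 1 / \<zeta>" using k(1) by (simp add: \<zeta>'_def)
    from complete_quotient_SucI[OF this zeta] k qC(1) show ?thesis
      by (intro exI[of _ "Suc k"]) (auto simp: A'_def)
  qed
qed

section \<open>Reversing the expansion\<close>

text \<open>
  For \<open>\<xi> = \<surd>d\<close> this is the element of \<open>\<int>[\<surd>d]\<close> whose norm is \<open>N\<^sub>j\<^sup>2 - d H\<^sub>j\<^sup>2\<close>. It obeys the same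
  recurrence as \<open>N\<close> and \<open>H\<close>.
\<close>

definition cf_combination :: "real \<Rightarrow> nat \<Rightarrow> real" where
  "cf_combination \<xi> j = of_int (cf_num \<xi> j) + of_int (cf_den \<xi> j) * \<xi>"

lemma cf_combination_Suc_Suc:
  "cf_combination \<xi> (Suc (Suc j)) =
     partial_quotient \<xi> (Suc j) * cf_combination \<xi> (Suc j) + cf_combination \<xi> j"
  by (simp add: cf_combination_def algebra_simps)

lemma cf_combination_pos_less_Suc:
  assumes "\<xi> \<notin> \<rat>" and "\<xi> > 1"
  shows "0 < cf_combination \<xi> j \<and> cf_combination \<xi> j < cf_combination \<xi> (Suc j)"
proof (induction j)
  case 0
  have "partial_quotient \<xi> 0 \<ge> 1" using assms(2) by (simp add: partial_quotient_def)
  then have "real_of_int (partial_quotient \<xi> 0) \<ge> 1" by linarith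
  then show ?case using assms(2) by (simp add: cf_combination_def)
next
  case (Suc j)
  have "real_of_int (partial_quotient \<xi> (Suc j)) \<ge> 1"
    using partial_quotient_Suc_ge_1[OF assms(1), of j] by linarith
  then have "partial_quotient \<xi> (Suc j) * cf_combination \<xi> (Suc j) \<ge> 1 * cf_combination \<xi> (Suc j)"
    using Suc by (intro mult_right_mono) auto
  with Suc show ?case unfolding cf_combination_Suc_Suc by linarith
qed

text \<open>
  By the recurrence, \<open>W\<^bsub>i+2\<^esub>/W\<^bsub>i+1\<^esub> = a\<^bsub>i+1\<^esub> + 1/(W\<^bsub>i+1\<^esub>/W\<^sub>i)\<close> with \<open>W\<^bsub>i+1\<^esub>/W\<^sub>i > 1\<close>, which is one step of the
  continued fraction algorithm. Once a complete quotient equals such a ratio, the following ones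
  are therefore the ratios with decreasing index.
\<close>

lemma palindrome:
  assumes "\<xi> \<notin> \<rat>" and "\<xi> > 1"
    and mid: "complete_quotient \<xi> K = cf_combination \<xi> (Suc K) / cf_combination \<xi> K"
    and "j \<le> K"
  shows "complete_quotient \<xi> (K + j) =
           cf_combination \<xi> (Suc (K - j)) / cf_combination \<xi> (K - j)"
  using \<open>j \<le> K\<close>
proof (induction j)
  case (Suc j)
  define i where "i = K - Suc j"
  have i: "K - j = Suc i" using Suc.prems by (simp add: i_def)
  let ?W = "cf_combination \<xi>"
  have W: "0 < ?W i" "?W i < ?W (Suc i)"
    using cf_combination_pos_less_Suc[OF assms(1,2)] by auto
  have "complete_quotient \<xi> (K + j) = ?W (Suc (Suc i)) / ?W (Suc i)"
    using Suc i by simp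
  also have "\<dots> = partial_quotient \<xi> (Suc i) + 1 / (?W (Suc i) / ?W i)"
    using W by (simp add: cf_combination_Suc_Suc field_simps)
  finally have "complete_quotient \<xi> (Suc (K + j)) = ?W (Suc i) / ?W i"
    using W by (intro complete_quotient_SucI(1)) auto
  then show ?case by (simp add: i_def)
qed (use mid in simp)

section \<open>Periods of an expansion\<close>

text \<open>
  The complete quotient \<open>x\<^sub>1\<close> is compared instead of \<open>x\<^sub>0\<close> because the repeating block begins with \<open>a\<^sub>1\<close>.
\<close>

lemma period_iff_complete_quotient:
  assumes "\<xi> \<notin> \<rat>"
  shows "(\<forall>i\<ge>1. partial_quotient \<xi> (i + l) = partial_quotient \<xi> i) \<longleftrightarrow>
           complete_quotient \<xi> (Suc l) = complete_quotient \<xi> 1"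
proof
  assume per: "\<forall>i\<ge>1. partial_quotient \<xi> (i + l) = partial_quotient \<xi> i"
  show "complete_quotient \<xi> (Suc l) = complete_quotient \<xi> 1"
  proof (rule partial_quotients_determine)
    fix i
    show "partial_quotient (complete_quotient \<xi> (Suc l)) i = partial_quotient (complete_quotient \<xi> 1) i"
      using per[rule_format, of "Suc i"]
      by (simp add: partial_quotient_complete_quotient add.commute del: complete_quotient.simps)
  qed (use complete_quotient_irrational[OF assms] in blast)+
next
  assume eq: "complete_quotient \<xi> (Suc l) = complete_quotient \<xi> 1"
  show "\<forall>i\<ge>1. partial_quotient \<xi> (i + l) = partial_quotient \<xi> i"
  proof (intro allI impI)
    fix i :: nat assume "i \<ge> 1"
    then obtain j where "i = Suc j" by (cases i) auto
    then show "partial_quotient \<xi> (i + l) = partial_quotient \<xi> i"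
      using partial_quotient_complete_quotient[of \<xi> "Suc l" j]
        partial_quotient_complete_quotient[of \<xi> 1 j]
      unfolding eq by (simp add: add.commute)
  qed
qed

lemma complete_quotient_shift_period:
  assumes "complete_quotient \<xi> (Suc l) = complete_quotient \<xi> 1"
  shows "complete_quotient \<xi> (Suc (l + j)) = complete_quotient \<xi> (Suc j)"
  using complete_quotient_add[of \<xi> "Suc l" j] complete_quotient_add[of \<xi> 1 j] unfolding assms
  by (simp del: complete_quotient.simps)

section \<open>Units of real quadratic fields\<close>

lemma of_int_add_mult_irrational_eq_iff:
  fixes a b c d :: int and s :: real
  assumes "s \<notin> \<rat>"
  shows "of_int a + of_int b * s = of_int c + of_int d * s \<longleftrightarrow> a = c \<and> b = d"
proof
  assume eq: "of_int a + of_int b * s = of_int c + of_int d * s"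
  have "b = d"
  proof (rule ccontr)
    assume "b \<noteq> d"
    then have "s = of_int (c - a) / of_int (b - d)" using eq by (simp add: field_simps)
    moreover have "of_int (c - a) / of_int (b - d) \<in> (\<rat> :: real set)"
      by (intro Rats_divide Rats_of_int)
    ultimately show False using assms by simp
  qed
  with eq show "a = c \<and> b = d" by simp
qed auto

lemma sqrt_prime_notin_Rats:
  fixes p :: nat
  assumes "prime p"
  shows "sqrt p \<notin> \<rat>"
proof
  assume "sqrt p \<in> \<rat>"
  then have "sqrt p \<in> \<int>" by (intro rational_algebraic_int_is_int algebraic_int_sqrt) auto
  then obtain k where k: "sqrt p = of_int k" by (auto elim: Ints_cases)
  have "real p = (of_int k)\<^sup>2" unfolding k[symmetric] by simp
  then have "of_int (int p) = (of_int (k\<^sup>2) :: real)" by simp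
  then have "int p = k\<^sup>2" by (simp only: of_int_eq_iff)
  then have "p = (nat \<bar>k\<bar>)\<^sup>2" by (metis nat_int nat_power_eq power2_abs abs_ge_zero)
  with assms show False by (simp add: prime_power_iff)
qed

definition int_span_sqrt :: "nat \<Rightarrow> real set" where
  "int_span_sqrt d = {of_int a + of_int b * sqrt d | a b. True}"

lemma int_span_sqrtI: "of_int a + of_int b * sqrt d \<in> int_span_sqrt d"
  by (auto simp: int_span_sqrt_def)

lemma Ints_subset_int_span_sqrt: "\<int> \<subseteq> int_span_sqrt d"
proof
  fix z :: real assume "z \<in> \<int>"
  then obtain k where "z = of_int k" by (auto elim: Ints_cases)
  then show "z \<in> int_span_sqrt d" using int_span_sqrtI[of k 0 d] by simp
qed

lemma int_span_sqrt_add: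
  "u \<in> int_span_sqrt d \<Longrightarrow> v \<in> int_span_sqrt d \<Longrightarrow> u + v \<in> int_span_sqrt d"
proof -
  assume "u \<in> int_span_sqrt d" "v \<in> int_span_sqrt d"
  then obtain a b a' b' where "u = of_int a + of_int b * sqrt d" "v = of_int a' + of_int b' * sqrt d"
    by (auto simp: int_span_sqrt_def)
  then have "u + v = of_int (a + a') + of_int (b + b') * sqrt d" by (simp add: algebra_simps)
  then show ?thesis using int_span_sqrtI by metis
qed

lemma int_span_sqrt_mult:
  "u \<in> int_span_sqrt d \<Longrightarrow> v \<in> int_span_sqrt d \<Longrightarrow> u * v \<in> int_span_sqrt d"
proof -
  assume "u \<in> int_span_sqrt d" "v \<in> int_span_sqrt d"
  then obtain a b a' b' where uv: "u = of_int a + of_int b * sqrt d" "v = of_int a' + of_int b' * sqrt d"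
    by (auto simp: int_span_sqrt_def)
  have "u * v = of_int (a * a') + of_int (a * b' + b * a') * sqrt d + of_int (b * b') * (sqrt d * sqrt d)"
    unfolding uv by (simp add: algebra_simps del: real_sqrt_mult_self)
  also have "\<dots> = of_int (a * a' + b * b' * int d) + of_int (a * b' + b * a') * sqrt d"
    by (simp add: algebra_simps)
  finally show ?thesis using int_span_sqrtI by metis
qed

lemma poly_in_int_span_sqrt:
  assumes "\<forall>i. coeff q i \<in> \<int>" and "u \<in> int_span_sqrt d"
  shows "poly q u \<in> int_span_sqrt d"
  using assms(1)
proof (induction q)
  case 0
  then show ?case using Ints_subset_int_span_sqrt[of d] by auto
next
  case (pCons a q)
  have "a \<in> \<int>" using pCons.prems[rule_format, of 0] by simp
  moreover have "\<forall>i. coeff q i \<in> \<int>" using pCons.prems[rule_format, of "Suc i" for i] by simp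
  ultimately show ?case using pCons.IH Ints_subset_int_span_sqrt[of d]
    by (auto intro!: int_span_sqrt_add int_span_sqrt_mult assms(2))
qed

text \<open>
  Multiplying \<open>v\<^sup>n + c\<^bsub>n-1\<^esub> v\<^bsup>n-1\<^esup> + \<dots> + c\<^sub>0 = 0\<close> by \<open>u\<^bsup>n-1\<^esup>\<close>, where \<open>u v = 1\<close>, gives
  \<open>v = - (c\<^bsub>n-1\<^esub> + c\<^bsub>n-2\<^esub> u + \<dots> + c\<^sub>0 u\<^bsup>n-1\<^esup>)\<close>, an integer polynomial in \<open>u\<close>. So the inverse stays in
  \<open>\<int>[\<surd>d]\<close>, whether or not that ring contains all integers of the field.
\<close>

lemma algebraic_int_inverse_in_int_span_sqrt:
  assumes "algebraic_int v" and "u * v = 1" and "u \<in> int_span_sqrt d"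
  shows "v \<in> int_span_sqrt d"
proof -
  \<comment> \<open>Reversing the coefficients turns the monic equation for \<open>v\<close> into one for \<open>u\<close> with constant term \<open>1\<close>.\<close>
  from assms(1) obtain f where f: "lead_coeff f = 1" "\<forall>i. coeff f i \<in> \<int>" "poly f v = 0"
    by (auto simp: algebraic_int.simps)
  have u: "u \<noteq> 0" "v = inverse u" using assms(2) by (auto simp: inverse_unique)
  obtain c q where cq: "reflect_poly f = pCons c q" by (cases "reflect_poly f")
  have "c = 1" using arg_cong[OF cq, of "\<lambda>g. coeff g 0"] f(1) by simp
  have "\<forall>i. coeff q i \<in> \<int>"
  proof
    fix i
    have "coeff q i = coeff (reflect_poly f) (Suc i)" by (simp add: cq)
    then show "coeff q i \<in> \<int>" using f(2) by (simp add: coeff_reflect_poly)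
  qed
  then have q: "poly q u \<in> int_span_sqrt d" by (rule poly_in_int_span_sqrt[OF _ assms(3)])
  have "poly (reflect_poly f) u = 0" using u f(3) by (simp add: poly_reflect_poly_nz)
  then have "u * poly q u = -1" by (simp add: cq \<open>c = 1\<close>)
  then have "v * (u * poly q u) = v * -1" by simp
  then have "v = -1 * poly q u" using assms(2) by (simp add: mult.assoc[symmetric] mult.commute[of v])
  then show ?thesis
    using int_span_sqrt_mult[OF subsetD[OF Ints_subset_int_span_sqrt, of "-1"] q] by simp
qed

text \<open>
  The inverse also has integer coordinates, and the norm is multiplicative.
\<close>

lemma integer_unit_norm:
  assumes "sqrt (real d) \<notin> \<rat>"
    and "of_int x + of_int y * sqrt (real d) \<in> integer_units (real_quadratic_field d)"
  shows "x\<^sup>2 - int d * y\<^sup>2 = 1 \<or> x\<^sup>2 - int d * y\<^sup>2 = -1"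
proof -
  let ?u = "of_int x + of_int y * sqrt (real d)"
  obtain v where v: "algebraic_int v" "?u * v = 1"
    using assms(2) by (auto simp: integer_units_def ring_of_integers_def)
  have "v \<in> int_span_sqrt d"
    by (rule algebraic_int_inverse_in_int_span_sqrt[OF v int_span_sqrtI])
  then obtain a b where ab: "v = of_int a + of_int b * sqrt d" by (auto simp: int_span_sqrt_def)
  have "of_int 1 + of_int 0 * sqrt d = ?u * v" using v(2) by simp
  also have "\<dots> = of_int (x * a) + of_int (x * b + y * a) * sqrt d + of_int (y * b) * (sqrt d * sqrt d)"
    unfolding ab by (simp add: algebra_simps del: real_sqrt_mult_self)
  also have "\<dots> = of_int (x * a + int d * (y * b)) + of_int (x * b + y * a) * sqrt d"
    by (simp add: algebra_simps)
  finally have "1 = x * a + int d * (y * b)" "0 = x * b + y * a"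
    unfolding of_int_add_mult_irrational_eq_iff[OF assms(1)] by auto
  moreover have "(x\<^sup>2 - int d * y\<^sup>2) * (a\<^sup>2 - int d * b\<^sup>2) =
      (x * a + int d * (y * b))\<^sup>2 - int d * (x * b + y * a)\<^sup>2"
    by (simp add: power2_eq_square algebra_simps)
  ultimately have "(x\<^sup>2 - int d * y\<^sup>2) * (a\<^sup>2 - int d * b\<^sup>2) = 1" by simp
  then show ?thesis using zmult_eq_1_iff by blast
qed

lemma pell_solution_in_integer_units:
  assumes "x\<^sup>2 - int d * y\<^sup>2 = e" and "e = 1 \<or> e = -1"
  shows "of_int x + of_int y * sqrt (real d) \<in> integer_units (real_quadratic_field d)"
proof -
  have ring: "of_int g + of_int h * sqrt (real d) \<in> ring_of_integers (real_quadratic_field d)"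
    for g h :: int
  proof -
    define z where "z = of_int g + of_int h * sqrt (real d)"
    have "(of_int h * sqrt (real d))\<^sup>2 = (of_int h)\<^sup>2 * real d" by (simp add: power_mult_distrib)
    moreover have "of_int h * sqrt (real d) = z - of_int g" by (simp add: z_def)
    ultimately have "(z - of_int g)\<^sup>2 = (of_int h)\<^sup>2 * real d" by simp
    then have "poly [:of_int (g\<^sup>2 - int d * h\<^sup>2), of_int (-2 * g), 1:] z = 0"
      by (simp add: power2_eq_square algebra_simps)
    moreover have "coeff [:of_int (g\<^sup>2 - int d * h\<^sup>2), of_int (-2 * g), 1:] i \<in> (\<int> :: real set)" for i
      by (auto simp: coeff_pCons split: nat.splits)
    ultimately have "algebraic_int z"
      by (intro algebraic_int.intros[of "[:of_int (g\<^sup>2 - int d * h\<^sup>2), of_int (-2 * g), 1:]"]) auto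
    moreover have "z \<in> real_quadratic_field d"
      unfolding real_quadratic_field_def z_def using Rats_of_int by blast
    ultimately show ?thesis by (simp add: ring_of_integers_def z_def)
  qed
  have "(of_int x + of_int y * sqrt (real d)) * (of_int (e * x) + of_int (- e * y) * sqrt (real d)) =
     of_int (e * x\<^sup>2) - of_int (e * y\<^sup>2) * (sqrt d * sqrt d)"
    by (simp add: power2_eq_square algebra_simps del: real_sqrt_mult_self)
  also have "\<dots> = of_int (e * (x\<^sup>2 - int d * y\<^sup>2))" by (simp add: algebra_simps)
  also have "\<dots> = 1" using assms by auto
  finally show ?thesis
    unfolding integer_units_def using ring[of x y] ring[of "e * x" "- e * y"] by blast
qed

section \<open>The fundamental unit as half a square\<close>

lemma coprime_mult_eq_squareE:
  fixes u v w :: int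
  assumes "coprime u v" and "u * v = w\<^sup>2" and "u > 0" and "v > 0"
  obtains r t where "u = r\<^sup>2" "v = t\<^sup>2" "r > 0" "t > 0"
proof -
  have "nat u * nat v = (nat \<bar>w\<bar>)\<^sup>2"
    using assms by (metis nat_mult_distrib nat_power_eq power2_abs abs_ge_zero order.strict_implies_order)
  moreover have "coprime (nat u) (nat v)" using assms by (simp add: coprime_nat_abs_left_iff coprime_int_iff[symmetric])
  ultimately have "is_nth_power 2 (nat u)" "is_nth_power 2 (nat v)"
    using is_nth_power_mult_coprime_natD[of "nat u" "nat v" 2] assms(3,4) by auto
  then obtain r t where rt: "nat u = r\<^sup>2" "nat v = t\<^sup>2" by (auto elim!: is_nth_powerE)
  then have "u = (int r)\<^sup>2" "v = (int t)\<^sup>2" using assms(3,4)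
    by (metis nat_0_le of_nat_power order.strict_implies_order)+
  moreover from this have "int r > 0" "int t > 0" using assms(3,4) by (auto intro!: Nat.gr0I)
  ultimately show ?thesis using that by blast
qed

lemma coprime_mult_eq_prime_times_squareE:
  fixes u v w q :: int
  assumes "coprime u v" and "u * v = q * w\<^sup>2" and "prime q" and "u > 0" and "v > 0"
  obtains r t where "u = q * r\<^sup>2" "v = t\<^sup>2" "r > 0" "t > 0" "\<bar>w\<bar> = r * t"
  | r t where "u = t\<^sup>2" "v = q * r\<^sup>2" "r > 0" "t > 0" "\<bar>w\<bar> = r * t"
proof -
  have main: thesis
    if c: "coprime u v" and m: "u * v = q * w\<^sup>2" and pos: "u > 0" "v > 0" and dvd: "q dvd u"
      and th: "\<And>r t. u = q * r\<^sup>2 \<Longrightarrow> v = t\<^sup>2 \<Longrightarrow> r > 0 \<Longrightarrow> t > 0 \<Longrightarrow> \<bar>w\<bar> = r * t \<Longrightarrow> thesis"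
    for u v :: int and thesis
  proof -
    from dvd obtain k where k: "u = q * k" by blast
    have q: "q > 0" using assms(3) by (simp add: prime_gt_0_int)
    have "k * v = w\<^sup>2" using m k q by simp
    moreover have "coprime k v" using c k by simp
    moreover have "k > 0" using k pos q by (simp add: zero_less_mult_iff)
    ultimately obtain r t where rt: "k = r\<^sup>2" "v = t\<^sup>2" "r > 0" "t > 0"
      using coprime_mult_eq_squareE pos(2) by metis
    have "\<bar>w\<bar>\<^sup>2 = (r * t)\<^sup>2" using \<open>k * v = w\<^sup>2\<close> rt by (simp add: power_mult_distrib)
    then have "\<bar>w\<bar> = r * t" using rt(3,4) by (subst (asm) power2_eq_iff_nonneg) auto
    with th rt k show ?thesis by blast
  qed
  have "q dvd u * v" using assms(2) by simp
  then consider "q dvd u" | "q dvd v" using assms(3) prime_dvd_mult_iff by blast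
  then show ?thesis
  proof cases
    case 1
    show ?thesis by (rule main[OF assms(1,2,4,5) 1]) (rule that(1))
  next
    case 2
    show ?thesis
      by (rule main[of v u]) (use assms 2 that(2) in \<open>auto simp: coprime_commute mult.commute\<close>)
  qed
qed

lemma square_mod_4_int: "(z::int)\<^sup>2 mod 4 = (if even z then 0 else 1)"
proof (cases "even z")
  case True
  then obtain k where "z = 2 * k" by blast
  then show ?thesis using True by (simp add: power2_eq_square)
next
  case False
  then obtain k where "z = 2 * k + 1" by (blast elim: oddE)
  then have "z\<^sup>2 = 1 + 4 * (k\<^sup>2 + k)" by (simp add: power2_eq_square algebra_simps)
  then have "z\<^sup>2 mod 4 = 1" by presburger
  then show ?thesis using False by simp
qed

text \<open>
  Modulo \<open>4\<close> the norm form becomes a sum of two squares, so it never takes the value \<open>-1\<close>, and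
  where it takes the value \<open>1\<close> exactly one of \<open>x, y\<close> is even.
\<close>

lemma norm_form_mod_4:
  fixes x y q :: int
  assumes "q mod 4 = 3"
  shows "(x\<^sup>2 - q * y\<^sup>2) mod 4 = (x\<^sup>2 mod 4 + y\<^sup>2 mod 4) mod 4"
proof -
  have q: "q = 4 * (q div 4) + 3" using assms div_mult_mod_eq[of q 4] by linarith
  define k where "k = q div 4"
  have "x\<^sup>2 - q * y\<^sup>2 = x\<^sup>2 + y\<^sup>2 + 4 * (- (k + 1) * y\<^sup>2)"
    using q unfolding k_def[symmetric] by (simp add: algebra_simps)
  then show ?thesis by (metis mod_add_eq mod_mult_self2)
qed

text \<open>
  Coprime factors of \<open>p\<close> times a square are a square and \<open>p\<close> times a square. This is applied twice to
  \<open>(x - 1)(x + 1) = p y\<^sup>2\<close>: to the halved factors, in order to rule out that \<open>x\<close> is odd, and to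
  the factors themselves. The sign \<open>e\<close> records that the square is \<open>x + e\<close>.
\<close>

lemma fundamental_unit_factorization:
  fixes p :: nat and x y :: int
  assumes "prime p" and "[p = 3] (mod 4)"
    and fund: "is_fundamental_unit (real_quadratic_field p) (of_int x + of_int y * sqrt (real p))"
  obtains a b e :: int where
    "e = 1 \<or> e = -1" "b\<^sup>2 - int p * a\<^sup>2 = 2 * e" "y = a * b" "a > 0" "b > 0" "odd a" "odd b"
    "(of_int b + of_int a * sqrt (real p))\<^sup>2 = 2 * (of_int x + of_int y * sqrt (real p))"
proof -
  define s where "s = sqrt (real p)"
  have irr: "s \<notin> \<rat>" using sqrt_prime_notin_Rats[OF assms(1)] by (simp add: s_def)
  have s2: "s * s = real p" by (simp add: s_def)
  have s: "s > 0" using assms(1) by (simp add: s_def prime_gt_0_nat)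
  have q4: "int p mod 4 = 3" using assms(2) zmod_int[of p 4] by (simp add: cong_def)
  have unit: "of_int x + of_int y * s \<in> integer_units (real_quadratic_field p)"
    and gt1: "of_int x + of_int y * s > 1"
    and least: "\<And>v. v \<in> integer_units (real_quadratic_field p) \<Longrightarrow> v > 1 \<Longrightarrow> of_int x + of_int y * s \<le> v"
    using fund by (auto simp: is_fundamental_unit_def s_def)
  have no_m1: "g\<^sup>2 - int p * h\<^sup>2 \<noteq> -1" for g h :: int
  proof
    assume "g\<^sup>2 - int p * h\<^sup>2 = -1"
    with norm_form_mod_4[OF q4, of g h] show False
      by (simp add: square_mod_4_int split: if_splits)
  qed
  have pell: "x\<^sup>2 - int p * y\<^sup>2 = 1"
    using integer_unit_norm[OF irr[unfolded s_def] unit[unfolded s_def]] no_m1 by blast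
  have conj: "(of_int x + of_int y * s) * (of_int x - of_int y * s) = 1"
  proof -
    have "(of_int x + of_int y * s) * (of_int x - of_int y * s) = of_int x * of_int x - of_int y * of_int y * (s * s)"
      by (simp add: algebra_simps)
    also have "\<dots> = of_int (x\<^sup>2 - int p * y\<^sup>2)" by (simp add: s2 power2_eq_square)
    finally show ?thesis by (simp add: pell)
  qed
  have c0: "of_int x - of_int y * s > 0"
    using conj gt1 by (metis less_trans zero_less_one zero_less_mult_pos)
  have c1: "of_int x - of_int y * s < 1"
  proof (rule ccontr)
    assume "\<not> ?thesis"
    then have "(of_int x + of_int y * s) * 1 \<le> (of_int x + of_int y * s) * (of_int x - of_int y * s)"
      using gt1 by (intro mult_left_mono) auto
    with conj gt1 show False by simp
  qed
  have "of_int x > (0::real)" using gt1 c0 by linarith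
  then have x: "x > 0" by simp
  have "of_int y * s > 0" using gt1 c1 by linarith
  then have y: "y > 0" using s by (simp add: zero_less_mult_iff)
  have x2: "x \<ge> 2"
  proof (rule ccontr)
    assume "\<not> ?thesis"
    then have "x = 1" using x by simp
    then show False using pell y assms(1) by (simp add: prime_gt_0_nat)
  qed
  have fact: "(x - 1) * (x + 1) = int p * y\<^sup>2" using pell by (simp add: power2_eq_square algebra_simps)
  have prime: "prime (int p)" using assms(1) by simp
  \<comment> \<open>If \<open>x\<close> is odd, then the fundamental unit is the square of the unit \<open>t + r s\<close>.\<close>
  have even_x: "even x"
  proof (rule ccontr)
    assume "odd x"
    then obtain m where m: "x = 2 * m + 1" by (blast elim: oddE)
    have m0: "m > 0" using m x2 by simp
    have "(x\<^sup>2 mod 4 + y\<^sup>2 mod 4) mod 4 = 1" using norm_form_mod_4[OF q4, of x y] pell by simp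
    then have "even y" using \<open>odd x\<close> by (simp add: square_mod_4_int split: if_splits)
    then obtain w where w: "y = 2 * w" by blast
    have mw: "m * (m + 1) = int p * w\<^sup>2" using fact unfolding m w by (simp add: power2_eq_square algebra_simps)
    have coprime_m: "coprime m (m + 1)" by (metis coprime_1_right coprime_iff_gcd_eq_1 gcd_add2)
    have "m + 1 > 0" using m0 by simp
    from coprime_m mw prime m0 this show False
    proof (cases rule: coprime_mult_eq_prime_times_squareE)
      case (1 r t)
      have w': "w = r * t" using 1(5) w y by simp
      define z where "z = of_int t + of_int r * s"
      have "t\<^sup>2 - int p * r\<^sup>2 = 1" using 1(1,2) by simp
      then have zu: "z \<in> integer_units (real_quadratic_field p)"
        using pell_solution_in_integer_units by (auto simp: z_def s_def)
      have z1: "z > 1"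
      proof -
        have "of_int t \<ge> (1::real)" using 1(4) by simp
        moreover have "of_int r * s > 0" using 1(3) s by simp
        ultimately show ?thesis by (simp add: z_def)
      qed
      have "z\<^sup>2 = of_int t * of_int t + of_int r * of_int r * (s * s) + 2 * of_int r * of_int t * s"
        by (simp add: z_def power2_eq_square algebra_simps)
      also have "\<dots> = of_int (t\<^sup>2 + int p * r\<^sup>2) + of_int (2 * (r * t)) * s"
        by (simp add: s2 power2_eq_square algebra_simps)
      also have "t\<^sup>2 + int p * r\<^sup>2 = x" using 1(1,2) m by simp
      also have "2 * (r * t) = y" using w w' by simp
      finally have "z\<^sup>2 = of_int x + of_int y * s" .
      then have "z * z \<le> z * 1" using least[OF zu z1] by (simp add: power2_eq_square)
      with z1 show False by (simp add: mult_le_cancel_left)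
    next
      case (2 r t)
      then have "t\<^sup>2 - int p * r\<^sup>2 = -1" by simp
      with no_m1 show False by blast
    qed
  qed
  have odd_y: "odd y"
    using norm_form_mod_4[OF q4, of x y] pell even_x
    by (auto simp: square_mod_4_int split: if_splits)
  have cop: "coprime (x - 1) (x + 1)"
  proof (rule coprimeI)
    fix c assume "c dvd x - 1" "c dvd x + 1"
    then have "c dvd x + 1 - (x - 1)" using dvd_diff by blast
    then have "c dvd 2" by simp
    moreover have "coprime 2 (x + 1)" using even_x by simp
    ultimately show "is_unit c" using \<open>c dvd x + 1\<close> by (meson coprime_common_divisor)
  qed
  note result = that
  have finish: thesis
    if "e = 1 \<or> e = -1" and b: "x + e = b\<^sup>2" and a: "x - e = int p * a\<^sup>2"
      and pos: "a > 0" "b > 0" and ab: "\<bar>y\<bar> = a * b" for e a b :: int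
  proof (rule result[of e b a])
    show "y = a * b" using ab y by simp
    then show "odd a" "odd b" using odd_y by auto
    show "b\<^sup>2 - int p * a\<^sup>2 = 2 * e" using a b by simp
    have "(of_int b + of_int a * s)\<^sup>2 = of_int b * of_int b + of_int a * of_int a * (s * s) + 2 * of_int a * of_int b * s"
      by (simp add: power2_eq_square algebra_simps)
    also have "\<dots> = of_int (b\<^sup>2 + int p * a\<^sup>2) + of_int (2 * (a * b)) * s"
      by (simp add: s2 power2_eq_square algebra_simps)
    also have "b\<^sup>2 + int p * a\<^sup>2 = 2 * x" using a b by simp
    also have "a * b = y" using \<open>y = a * b\<close> by simp
    finally show "(of_int b + of_int a * sqrt (real p))\<^sup>2 = 2 * (of_int x + of_int y * sqrt (real p))"
      by (simp add: s_def)
  qed (use that in auto)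
  have "x - 1 > 0" "x + 1 > 0" using x2 by auto
  from cop fact prime this show thesis
  proof (cases rule: coprime_mult_eq_prime_times_squareE)
    case (1 r t)
    then show thesis by (intro finish[of 1 t r]) auto
  next
    case (2 r t)
    then show thesis by (intro finish[of "-1" t r]) auto
  qed
qed

section \<open>The middle of the period\<close>

text \<open>
  The tail \<open>\<zeta>\<close> with \<open>s = (b \<zeta> + B)/(a \<zeta> + D)\<close> is sought in the form \<open>(Q + s)/2\<close>. Comparing coefficients of
  \<open>1\<close> and \<open>s\<close> forces \<open>D = (b - a Q)/2\<close> and \<open>B = (a p - b Q)/2\<close>, and the determinant is then
  \<open>(b\<^sup>2 - p a\<^sup>2)/2 = e\<close>. As \<open>a\<close>, \<open>b\<close> and \<open>p\<close> are odd, \<open>Q\<close> has to be odd, too.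

  The bounds on \<open>D\<close> amount to \<open>a Q \<le> b \<le> a (Q + 2)\<close>, with strict inequality on one side. They hold
  because \<open>Q\<^sup>2\<close> and \<open>(Q + 2)\<^sup>2\<close> are \<open>1\<close> modulo \<open>4\<close> and \<open>p\<close> is \<open>3\<close>, so that both squares keep a distance
  of at least \<open>2\<close> from \<open>p\<close>.
\<close>

lemma middle_complete_quotient:
  fixes p :: nat and a b e :: int
  assumes "p > 1" and "[p = 3] (mod 4)"
    and e: "e = 1 \<or> e = -1" and ab: "b\<^sup>2 - int p * a\<^sup>2 = 2 * e"
    and pos: "a > 0" "b > 0" and odd: "odd a" "odd b"
  obtains K where
    "K > 0" "cf_num (sqrt p) K = b" "cf_den (sqrt p) K = a"
    "complete_quotient (sqrt p) K = cf_combination (sqrt p) (Suc K) / cf_combination (sqrt p) K"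
proof -
  define s where "s = sqrt (real p)"
  have s2: "s * s = real p" by (simp add: s_def)
  have s: "s > 1" using assms(1) by (simp add: s_def)
  \<comment> \<open>The largest odd integer that is at most \<open>s\<close>.\<close>
  define Q where "Q = 2 * \<lfloor>(s - 1) / 2\<rfloor> + 1"
  have Qs: "of_int Q \<le> s" "s < of_int Q + 2"
    using floor_correct[of "(s - 1) / 2"] by (simp_all add: Q_def field_simps)
  have "\<lfloor>(s - 1) / 2\<rfloor> \<ge> 0" using s by simp
  then have Q: "Q \<ge> 1" "odd Q" by (auto simp: Q_def)
  have q4: "int p mod 4 = 3" using assms(2) zmod_int[of p 4] by (simp add: cong_def)
  have "of_int Q * of_int Q \<le> s * s" using Qs(1) Q(1) s by (intro mult_mono) auto
  then have "of_int (Q * Q) \<le> (of_int (int p) :: real)" by (simp add: s2)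
  then have "Q\<^sup>2 \<le> int p" by (simp only: of_int_le_iff power2_eq_square)
  moreover have "s * s < (of_int Q + 2) * (of_int Q + 2)" using Qs(2) s by (intro mult_strict_mono) auto
  then have "of_int (int p) < (of_int ((Q + 2) * (Q + 2)) :: real)" by (simp add: s2)
  then have "int p < (Q + 2)\<^sup>2" by (simp only: of_int_less_iff power2_eq_square)
  moreover have "Q\<^sup>2 mod 4 = 1" "(Q + 2)\<^sup>2 mod 4 = 1" using Q(2) by (simp_all add: square_mod_4_int)
  ultimately have pQ: "Q\<^sup>2 + 2 \<le> int p" "int p + 2 \<le> (Q + 2)\<^sup>2" using q4 by presburger+
  have "even (b - a * Q)" "even (a * int p - b * Q)"
  proof -
    have "odd (int p)" using q4 by presburger
    then show "even (b - a * Q)" "even (a * int p - b * Q)" using odd Q(2) by auto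
  qed
  then obtain D B where D: "b - a * Q = 2 * D" and B: "a * int p - b * Q = 2 * B"
    unfolding dvd_def by blast
  define \<zeta> where "\<zeta> = (of_int Q + s) / 2"
  have D': "of_int b - of_int a * of_int Q = 2 * (of_int D :: real)"
    using arg_cong[OF D, of real_of_int] by simp
  have B': "of_int a * real p - of_int b * of_int Q = 2 * (of_int B :: real)"
    using arg_cong[OF B, of real_of_int] by simp
  have "of_int Q \<ge> (1::real)" using Q(1) by simp
  then have \<zeta>1: "\<zeta> > 1" using s by (simp add: \<zeta>_def)
  have rel: "s * (of_int a * \<zeta> + of_int D) = of_int b * \<zeta> + of_int B"
  proof -
    have "2 * (s * (of_int a * \<zeta> + of_int D)) = s * (of_int a * (of_int Q + s) + 2 * of_int D)"
      by (simp add: \<zeta>_def algebra_simps)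
    also have "\<dots> = of_int a * (s * s) + of_int b * s"
      unfolding D'[symmetric] by (simp add: algebra_simps)
    also have "\<dots> = of_int b * (of_int Q + s) + 2 * of_int B"
      unfolding B'[symmetric] s2 by (simp add: algebra_simps)
    also have "\<dots> = 2 * (of_int b * \<zeta> + of_int B)" by (simp add: \<zeta>_def algebra_simps)
    finally show ?thesis by simp
  qed
  have "2 * (b * D - B * a) = b * (2 * D) - (2 * B) * a" by (simp add: algebra_simps)
  also have "\<dots> = 2 * e" unfolding D[symmetric] B[symmetric] ab[symmetric]
    by (simp add: power2_eq_square algebra_simps)
  finally have det: "b * D - B * a = e" by simp
  have a2: "a\<^sup>2 \<ge> 1" using pos(1) by (simp add: int_one_le_iff_zero_less)
  have lower: "(a * Q)\<^sup>2 + 2 * a\<^sup>2 \<le> int p * a\<^sup>2"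
    using mult_right_mono[OF pQ(1), of "a\<^sup>2"] by (simp add: algebra_simps power_mult_distrib)
  have upper: "int p * a\<^sup>2 + 2 * a\<^sup>2 \<le> (a * (Q + 2))\<^sup>2"
    using mult_right_mono[OF pQ(2), of "a\<^sup>2"]
    by (simp only: power_mult_distrib distrib_right mult.commute[of "a\<^sup>2"]) simp
  have range: "e = 1 \<and> 0 < D \<and> D \<le> a \<or> e = -1 \<and> 0 \<le> D \<and> D < a"
    using e
  proof
    assume e: "e = 1"
    have "(a * Q)\<^sup>2 < b\<^sup>2" using lower ab e a2 by linarith
    then have "a * Q < b" by (rule power2_less_imp_less) (use pos in simp)
    moreover have "b\<^sup>2 \<le> (a * (Q + 2))\<^sup>2" using upper ab e a2 by linarith
    then have "b \<le> a * (Q + 2)" by (rule power2_le_imp_le) (use pos Q in simp)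
    ultimately show ?thesis using e D by (simp add: algebra_simps)
  next
    assume e: "e = -1"
    have "(a * Q)\<^sup>2 \<le> b\<^sup>2" using lower ab e a2 by linarith
    then have "a * Q \<le> b" by (rule power2_le_imp_le) (use pos in simp)
    moreover have "b\<^sup>2 < (a * (Q + 2))\<^sup>2" using upper ab e a2 by linarith
    then have "b < a * (Q + 2)" by (rule power2_less_imp_less) (use pos Q in simp)
    ultimately show ?thesis using e D by (simp add: algebra_simps)
  qed
  obtain k where k: "complete_quotient s (Suc k) = \<zeta>"
      "cf_num s (Suc k) = b" "cf_num s k = B" "cf_den s (Suc k) = a" "cf_den s k = D"
    using moebius_complete_quotient[OF rel \<zeta>1 det range] by blast
  \<comment> \<open>The backward ratio at \<open>K\<close> agrees with \<open>x\<^sub>K\<close>, since \<open>B + D s = (b + a s)(s - Q)/2\<close>.\<close>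
  have "partial_quotient s (Suc k) = Q"
    unfolding partial_quotient_def k(1) \<zeta>_def using Qs by (intro floor_unique) auto
  then have "2 * cf_combination s (Suc (Suc k)) =
      2 * of_int Q * (of_int b + of_int a * s) + 2 * of_int B + 2 * of_int D * s"
    unfolding cf_combination_Suc_Suc by (simp add: cf_combination_def k algebra_simps)
  also have "\<dots> = (of_int Q + s) * (of_int b + of_int a * s)"
    unfolding B'[symmetric] D'[symmetric] s2[symmetric] by (simp add: algebra_simps)
  also have "\<dots> = 2 * (\<zeta> * cf_combination s (Suc k))"
    by (simp add: cf_combination_def k \<zeta>_def)
  finally have "cf_combination s (Suc (Suc k)) = \<zeta> * cf_combination s (Suc k)" by simp
  moreover have "cf_combination s (Suc k) > 0"
    using pos s by (simp add: cf_combination_def k add_pos_pos)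
  ultimately have "complete_quotient s (Suc k) = cf_combination s (Suc (Suc k)) / cf_combination s (Suc k)"
    by (simp add: k(1) del: complete_quotient.simps)
  then show thesis using that[of "Suc k"] k by (simp only: s_def)
qed

text \<open>
  If \<open>l\<close> is a period, then \<open>x\<^sub>l = s + t\<close> with an integer \<open>t\<close>. Expressing \<open>s\<close> by this tail and comparing
  coefficients determines \<open>N\<^bsub>l-1\<^esub>\<close> and \<open>H\<^bsub>l-1\<^esub>\<close> in terms of \<open>N\<^sub>l\<close>, \<open>H\<^sub>l\<close> and \<open>t\<close>, whereupon the determinant
  \<open>N\<^sub>l H\<^bsub>l-1\<^esub> - N\<^bsub>l-1\<^esub> H\<^sub>l = \<plusminus>1\<close> turns into the norm of \<open>W\<^sub>l\<close>.
\<close>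

lemma cf_combination_period_in_integer_units:
  assumes irr: "sqrt (real d) \<notin> \<rat>" and "l > 0"
    and per: "complete_quotient (sqrt d) (Suc l) = complete_quotient (sqrt d) 1"
  shows "cf_combination (sqrt d) l \<in> integer_units (real_quadratic_field d)"
proof -
  define s where "s = sqrt (real d)"
  have s2: "s * s = real d" by (simp add: s_def)
  obtain k where k: "l = Suc k" using \<open>l > 0\<close> by (cases l) auto
  define t where "t = partial_quotient s l - partial_quotient s 0"
  define N N' H H' where "N = cf_num s l" "N' = cf_num s k" "H = cf_den s l" "H' = cf_den s k"
  note NH = N_N'_H_H'_def
  have "complete_quotient s l = of_int t + s"
    using complete_quotient_eq_Suc[of s l] complete_quotient_eq_Suc[of s 0] per
    by (simp add: t_def s_def del: complete_quotient.simps(2))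
  then have "s * (of_int H * (of_int t + s) + of_int H') = of_int N * (of_int t + s) + of_int N'"
    using eq_num_den_complete_quotient[of s k] irr by (simp add: NH k s_def del: complete_quotient.simps)
  then have "of_int (N * t + N') + of_int N * s =
      of_int H * (s * s) + of_int (H * t + H') * s"
    by (simp add: algebra_simps)
  also have "\<dots> = of_int (H * int d) + of_int (H * t + H') * s" by (simp add: s2)
  finally have "N * t + N' = H * int d" "N = H * t + H'"
    using of_int_add_mult_irrational_eq_iff[OF irr[folded s_def]] by blast+
  then have eq: "N' = H * int d - N * t" "H' = N - H * t" by simp_all
  have "N * H' - N' * H = (-1) ^ l" using cf_determinant[of s k] by (simp add: NH k)
  then have "N\<^sup>2 - int d * H\<^sup>2 = (-1) ^ l"
    unfolding eq by (simp add: power2_eq_square algebra_simps)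
  moreover have "(-1) ^ l = (1::int) \<or> (-1) ^ l = (-1::int)" by (cases "even l") auto
  ultimately show ?thesis
    using pell_solution_in_integer_units[of N d H] by (simp add: cf_combination_def NH s_def)
qed

text \<open>
  Symmetry about \<open>K\<close> only shows that \<open>2K\<close> is a period. That no shorter one exists comes
  from the size of units: a period \<open>l \<le> K\<close> would give \<open>W\<^sub>K\<^sup>2/2 = u \<le> W\<^sub>l \<le> W\<^sub>K\<close>, hence \<open>W\<^sub>K \<le> 2\<close>, and a
  period strictly between \<open>K\<close> and \<open>2K\<close> would leave the shorter period \<open>2K - l\<close>.
\<close>

lemma cf_period_length_eq_twice_middle:
  fixes d :: nat
  assumes irr: "sqrt (real d) \<notin> \<rat>" and "d > 1" and "K > 0"
    and mid: "complete_quotient (sqrt d) K = cf_combination (sqrt d) (Suc K) / cf_combination (sqrt d) K"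
    and fund: "is_fundamental_unit (real_quadratic_field d) u"
    and sq: "(cf_combination (sqrt d) K)\<^sup>2 = 2 * u"
    and gt2: "cf_combination (sqrt d) K > 2"
  shows "cf_period_length (sqrt d) = 2 * K"
proof -
  define s where "s = sqrt (real d)"
  note irr = irr[folded s_def]
  have s: "s > 1" using assms(2) by (simp add: s_def)
  let ?per = "\<lambda>l. complete_quotient s (Suc l) = complete_quotient s 1"
  let ?W = "cf_combination s"
  have length: "cf_period_length s = (LEAST l. l > 0 \<and> ?per l)"
    unfolding cf_period_length_def period_iff_complete_quotient[OF irr] ..
  define l where "l = cf_period_length s"
  have "complete_quotient s (2 * K) = ?W 1 / ?W 0"
    using palindrome[OF irr s mid[folded s_def], of K] by (simp add: mult_2)
  also have "\<dots> = of_int \<lfloor>s\<rfloor> + s" by (simp add: cf_combination_def partial_quotient_def)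
  finally have "frac (complete_quotient s (2 * K)) = frac s" by (simp add: frac_def)
  then have per2K: "?per (2 * K)" by simp
  then have l: "l > 0" "?per l" "l \<le> 2 * K"
    using LeastI[of "\<lambda>l. l > 0 \<and> ?per l" "2 * K"] Least_le[of "\<lambda>l. l > 0 \<and> ?per l" "2 * K"] \<open>K > 0\<close>
    unfolding l_def length by auto
  have minimal: "\<not> (0 < m \<and> ?per m)" if "m < l" for m
    using not_less_Least[of m "\<lambda>l. l > 0 \<and> ?per l"] that unfolding l_def length by blast
  have mono: "strict_mono ?W"
    using cf_combination_pos_less_Suc[OF irr s] by (simp add: strict_mono_Suc_iff)
  have "K < l"
  proof (rule ccontr)
    assume "\<not> K < l"
    then have "?W l \<le> ?W K" using mono by (simp add: strict_mono_less_eq)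
    moreover have "?W 0 < ?W l" using mono l(1) by (simp add: strict_mono_less)
    then have "?W l > 1" by (simp add: cf_combination_def)
    then have "u \<le> ?W l"
      using fund cf_combination_period_in_integer_units[of d l] irr l
      by (simp add: is_fundamental_unit_def s_def)
    ultimately have "?W K * ?W K \<le> 2 * ?W K" using sq by (simp add: s_def power2_eq_square)
    then show False using gt2 by (simp add: s_def)
  qed
  have "?per (2 * K - l)"
    using complete_quotient_shift_period[OF l(2), of "2 * K - l"] per2K l(3) by simp
  then have "\<not> (2 * K - l < l \<and> 0 < 2 * K - l)" using minimal by blast
  with \<open>K < l\<close> l(3) have "2 * K = l" by linarith
  then show ?thesis by (simp add: l_def s_def)
qed

theorem theorem4p1:
  fixes p :: nat and x y :: int and l :: nat
  assumes "prime p" and "[p = 3] (mod 4)"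
    and "is_fundamental_unit (real_quadratic_field p) (of_int x + of_int y * sqrt (real p))"
    and "l = cf_period_length (sqrt (real p))"
  shows "int p dvd y \<longleftrightarrow> int p dvd convergent_denom (sqrt (real p)) (l div 2 - 1)"
proof -
  obtain a b e :: int where
    e: "e = 1 \<or> e = -1" and ab: "b\<^sup>2 - int p * a\<^sup>2 = 2 * e" and y: "y = a * b"
    and pos: "a > 0" "b > 0" and odd: "odd a" "odd b"
    and sq: "(of_int b + of_int a * sqrt (real p))\<^sup>2 = 2 * (of_int x + of_int y * sqrt (real p))"
    using fundamental_unit_factorization[OF assms(1-3)] by blast
  have p: "p > 1" using assms(1) by (rule prime_gt_1_nat)
  obtain K where K: "K > 0" "cf_num (sqrt p) K = b" "cf_den (sqrt p) K = a"
    and mid: "complete_quotient (sqrt p) K = cf_combination (sqrt p) (Suc K) / cf_combination (sqrt p) K"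
    using middle_complete_quotient[OF p assms(2) e ab pos odd] by blast
  have W: "cf_combination (sqrt p) K = of_int b + of_int a * sqrt p"
    by (simp add: cf_combination_def K)
  have "1 * 1 < of_int a * sqrt p"
    using pos p by (intro mult_le_less_imp_less) auto
  moreover have "of_int b \<ge> (1::real)" using pos by simp
  ultimately have "cf_combination (sqrt p) K > 2" by (simp add: W)
  then have "l = 2 * K"
    unfolding assms(4)
    using sqrt_prime_notin_Rats[OF assms(1)] p K(1) mid assms(3) sq[folded W]
    by (intro cf_period_length_eq_twice_middle)
  then have a: "convergent_denom (sqrt p) (l div 2 - 1) = a"
    using K by (simp add: convergent_denom_eq_cf_den)
  have "\<not> int p dvd b"
  proof
    assume "int p dvd b"
    then have "int p dvd b\<^sup>2 - int p * a\<^sup>2" by (simp add: power2_eq_square)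
    then have "int p dvd 2" using ab e by auto
    then have "int p \<le> 2" by (rule zdvd_imp_le) simp
    then show False using p assms(2) by (simp add: cong_def)
  qed
  then show ?thesis unfolding a y using assms(1) by (simp add: prime_dvd_mult_iff)
qed

end
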